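(* Let $A$ be a skew left brace. Then $A$ has finite multipermutation level if and only if $A$ is right nilpotent and the additive group $(A,+)$ is nilpotent.
   Context: A skew left brace is a triple $(A,+,\circ)$ where $(A,+)$ and $(A,\circ)$ are (not necessarily abelian) groups such that $a\circ(b+c)=a\circ b-a+a\circ c$ for all $a,b,c\in A$. The two groups share the same neutral element, denoted $0$. The zero skew left brace is $\{0\}$, also denoted $0$. For $a,b\in A$ put $a*b=-a+a\circ b-b$. For subsets $X,Y\subseteq A$, $X*Y$ denotes the subgroup of $(A,+)$ generated by all $x*y$ with $x\in X$, $y\in Y$. The right series of $A$ is defined by $A^{(1)}=A$ and $A^{(n+1)}=A^{(n)}*A$ for $n\ge 1$; $A$ is right nilpotent if $A^{(m)}=0$ for some $m\ge 1$. The socle of $A$ is $\mathrm{Soc}(A)=\{x\in A: x\circ a=x+a \text{ and } x+a=a+x \text{ for all } a\in A\}$; it is an ideal of $A$ (a subset that is a normal subgroup of both $(A,+)$ and $(A,\circ)$ and is stable under all maps $b\mapsto -a+a\circ b$, $a\in A$), so the quotient $A/\mathrm{Soc}(A)$ is a skew left brace. $A$ has finite multipermutation level if the sequence defined by $S_1=A$ and $S_{n+1}=S_n/\mathrm{Soc}(S_n)$ for $n\ge 1$ reaches zero, i.e. $S_n=0$ for some $n$. *)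

theory Defs
  imports "HOL-Algebra.Weak_Morphisms" "HOL-Algebra.Generated_Groups"
begin

section \<open>Skew left braces\<close>

text \<open>
  A skew left brace is carried by the record type of rings: the (not necessarily abelian) group
  operation $+$ is the \<^const>\<open>add\<close> field and the group operation $\circ$ is the \<^const>\<open>mult\<close>
  field. That the two neutral elements coincide follows from the axioms, see \<open>one_eq_zero\<close> below.
\<close>

locale skew_left_brace =
  fixes A (structure)
  assumes add_group: "group (add_monoid A)"
    and circ_group: "group A"
    and brace_eq: "\<lbrakk>a \<in> carrier A; b \<in> carrier A; c \<in> carrier A\<rbrakk>
      \<Longrightarrow> a \<otimes> (b \<oplus> c) = ((a \<otimes> b) \<ominus> a) \<oplus> (a \<otimes> c)"

definition brace_star :: "('a, 'm) ring_scheme \<Rightarrow> 'a \<Rightarrow> 'a \<Rightarrow> 'a" where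
  "brace_star A a b = ((\<ominus>\<^bsub>A\<^esub> a) \<oplus>\<^bsub>A\<^esub> (a \<otimes>\<^bsub>A\<^esub> b)) \<ominus>\<^bsub>A\<^esub> b"

definition brace_star_set :: "('a, 'm) ring_scheme \<Rightarrow> 'a set \<Rightarrow> 'a set \<Rightarrow> 'a set" where
  "brace_star_set A X Y = generate (add_monoid A) {brace_star A x y | x y. x \<in> X \<and> y \<in> Y}"

text \<open>The index is shifted by one: \<open>right_series A n\<close> is $A^{(n+1)}$.\<close>

primrec right_series :: "('a, 'm) ring_scheme \<Rightarrow> nat \<Rightarrow> 'a set" where
  "right_series A 0 = carrier A"
| "right_series A (Suc n) = brace_star_set A (right_series A n) (carrier A)"

definition right_nilpotent :: "('a, 'm) ring_scheme \<Rightarrow> bool" where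
  "right_nilpotent A \<longleftrightarrow> (\<exists>n. right_series A n = {\<zero>\<^bsub>A\<^esub>})"

text \<open>Lower central series: \<open>lower_central G n\<close> is $\gamma_{n+1}(G)$.\<close>

primrec lower_central :: "('a, 'm) monoid_scheme \<Rightarrow> nat \<Rightarrow> 'a set" where
  "lower_central G 0 = carrier G"
| "lower_central G (Suc n) = generate G
     {x \<otimes>\<^bsub>G\<^esub> y \<otimes>\<^bsub>G\<^esub> inv\<^bsub>G\<^esub> x \<otimes>\<^bsub>G\<^esub> inv\<^bsub>G\<^esub> y | x y. x \<in> lower_central G n \<and> y \<in> carrier G}"

definition nilpotent_group :: "('a, 'm) monoid_scheme \<Rightarrow> bool" where
  "nilpotent_group G \<longleftrightarrow> group G \<and> (\<exists>n. lower_central G n = {\<one>\<^bsub>G\<^esub>})"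

definition socle :: "('a, 'm) ring_scheme \<Rightarrow> 'a set" where
  "socle A = {x \<in> carrier A. \<forall>a \<in> carrier A.
     x \<otimes>\<^bsub>A\<^esub> a = x \<oplus>\<^bsub>A\<^esub> a \<and> x \<oplus>\<^bsub>A\<^esub> a = a \<oplus>\<^bsub>A\<^esub> x}"

definition zero_brace :: "('a, 'm) ring_scheme \<Rightarrow> bool" where
  "zero_brace A \<longleftrightarrow> carrier A = {\<zero>\<^bsub>A\<^esub>}"

text \<open>
  The carrier of \<open>A Quot socle A\<close> consists of cosets, so it has type \<open>'a set\<close>, and iterating the
  quotient would change the type at every step. Therefore each quotient is transported back to
  the type \<open>'a\<close>, along the injection that chooses a representative of every coset;
  \<open>mp_series_Suc_iso\<close> below states that this transport is an isomorphism.
  The index is shifted by one: \<open>mp_series A n\<close> is $S_{n+1}$.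
\<close>

definition coset_rep :: "'a set \<Rightarrow> 'a" where
  "coset_rep C = (SOME x. x \<in> C)"

primrec mp_series :: "'a ring \<Rightarrow> nat \<Rightarrow> 'a ring" where
  "mp_series A 0 = A"
| "mp_series A (Suc n) =
     image_ring coset_rep (mp_series A n Quot socle (mp_series A n))"

definition finite_multipermutation_level :: "'a ring \<Rightarrow> bool" where
  "finite_multipermutation_level A \<longleftrightarrow> (\<exists>n. zero_brace (mp_series A n))"


section \<open>Well-definedness of the quotients\<close>

definition brace_ideal :: "'a set \<Rightarrow> ('a, 'm) ring_scheme \<Rightarrow> bool" where
  "brace_ideal I A \<longleftrightarrow> I \<lhd> add_monoid A \<and> I \<lhd> A \<and>
     (\<forall>a \<in> carrier A. \<forall>b \<in> I. (\<ominus>\<^bsub>A\<^esub> a) \<oplus>\<^bsub>A\<^esub> (a \<otimes>\<^bsub>A\<^esub> b) \<in> I)"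

context skew_left_brace
begin

sublocale add: group "add_monoid A"
  rewrites "carrier (add_monoid A) = carrier A"
    and "mult (add_monoid A) = add A"
    and "one (add_monoid A) = zero A"
    and "m_inv (add_monoid A) = a_inv A"
    and "r_coset (add_monoid A) = a_r_coset A"
  by (rule add_group) (simp_all add: a_inv_def a_r_coset_def)

sublocale circ: group A
  by (rule circ_group)

lemma one_eq_zero: "\<one> = \<zero>"
proof -
  have "\<one> \<otimes> (\<zero> \<oplus> \<zero>) = ((\<one> \<otimes> \<zero>) \<ominus> \<one>) \<oplus> (\<one> \<otimes> \<zero>)"
    by (rule brace_eq) auto
  then have "\<ominus> \<one> = \<zero>"
    by (simp add: a_minus_def)
  then show ?thesis
    by (metis add.inv_inv add.inv_one circ.one_closed)
qed

lemma socleD: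
  assumes "x \<in> socle A"
  shows "x \<in> carrier A" "\<And>a. a \<in> carrier A \<Longrightarrow> x \<otimes> a = x \<oplus> a"
    "\<And>a. a \<in> carrier A \<Longrightarrow> x \<oplus> a = a \<oplus> x"
  using assms by (auto simp: socle_def)

lemma circ_minus:
  assumes "a \<in> carrier A" "b \<in> carrier A" "c \<in> carrier A"
  shows "(\<ominus> a) \<oplus> (a \<otimes> (b \<oplus> c)) = ((\<ominus> a) \<oplus> (a \<otimes> b)) \<oplus> ((\<ominus> a) \<oplus> (a \<otimes> c))"
  using assms by (simp add: brace_eq a_minus_def add.m_assoc)

lemma socle_lambda:
  assumes a: "a \<in> carrier A" and b: "b \<in> socle A"
  defines "c \<equiv> (\<ominus> a) \<oplus> (a \<otimes> b)"
  shows "c \<in> socle A" and "a \<otimes> b \<otimes> inv a = c"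
proof -
  have bc: "b \<in> carrier A" using b by (rule socleD)
  have cc: "c \<in> carrier A" using a bc by (simp add: c_def)
  have ab: "a \<otimes> b = a \<oplus> c" using a bc by (simp add: c_def add.m_assoc[symmetric])
  have central: "c \<oplus> y = y \<oplus> c" if y: "y \<in> carrier A" for y
  proof -
    define z where "z = inv a \<otimes> (a \<oplus> y)"
    have z: "z \<in> carrier A" using a y by (simp add: z_def)
    have "a \<otimes> z = a \<oplus> y" using a y by (simp add: z_def circ.m_assoc[symmetric])
    then have az: "(\<ominus> a) \<oplus> (a \<otimes> z) = y" using a y by (simp add: add.m_assoc[symmetric])
    have "b \<oplus> z = z \<oplus> b" using b z by (rule socleD)
    then show ?thesis
      using circ_minus[OF a bc z] circ_minus[OF a z bc] az by (simp add: c_def)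
  qed
  have key: "a \<otimes> (b \<otimes> w) = c \<oplus> (a \<otimes> w)" if w: "w \<in> carrier A" for w
  proof -
    have "a \<otimes> (b \<otimes> w) = a \<otimes> (b \<oplus> w)" using socleD(2)[OF b w] by simp
    also have "\<dots> = ((a \<oplus> c) \<ominus> a) \<oplus> (a \<otimes> w)" using brace_eq[OF a bc w] ab by simp
    also have "(a \<oplus> c) \<ominus> a = c" using a cc central[OF a]
      by (simp add: a_minus_def add.m_assoc flip: central)
    finally show ?thesis .
  qed
  show conj: "a \<otimes> b \<otimes> inv a = c"
    using key[of "inv a"] a bc cc by (simp add: circ.m_assoc one_eq_zero)
  have "c \<otimes> d = c \<oplus> d" if d: "d \<in> carrier A" for d
  proof -
    have "c \<otimes> d = a \<otimes> (b \<otimes> (inv a \<otimes> d))"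
      using a bc d by (simp add: conj[symmetric] circ.m_assoc)
    also have "\<dots> = c \<oplus> d"
      using key[of "inv a \<otimes> d"] a d by (simp add: circ.m_assoc[symmetric])
    finally show ?thesis .
  qed
  then show "c \<in> socle A" using central cc by (simp add: socle_def)
qed

lemma socle_add:
  assumes x: "x \<in> socle A" and y: "y \<in> socle A"
  shows "x \<oplus> y \<in> socle A"
proof -
  note xc = socleD(1)[OF x] and yc = socleD(1)[OF y]
  have "(x \<oplus> y) \<otimes> a = (x \<oplus> y) \<oplus> a" if a: "a \<in> carrier A" for a
  proof -
    have "(x \<oplus> y) \<otimes> a = x \<otimes> (y \<otimes> a)"
      using a xc yc socleD(2)[OF x yc] by (simp add: circ.m_assoc[symmetric])
    also have "\<dots> = x \<oplus> (y \<oplus> a)"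
      using a yc socleD(2)[OF y a] socleD(2)[OF x, of "y \<oplus> a"] by simp
    finally show ?thesis using a xc yc by (simp add: add.m_assoc)
  qed
  moreover have "(x \<oplus> y) \<oplus> a = a \<oplus> (x \<oplus> y)" if a: "a \<in> carrier A" for a
    by (metis a add.m_assoc socleD(1,3) x y)
  ultimately show ?thesis using xc yc by (simp add: socle_def)
qed

lemma socle_minus:
  assumes x: "x \<in> socle A"
  shows "\<ominus> x \<in> socle A" and "inv x = \<ominus> x"
proof -
  note xc = socleD(1)[OF x]
  have "x \<oplus> inv x = \<zero>" using socleD(2)[OF x, of "inv x"] xc by (simp add: one_eq_zero)
  then show inv: "inv x = \<ominus> x"
    using xc by (metis add.inv_equality add.inv_inv circ.inv_closed)
  have "(\<ominus> x) \<otimes> a = (\<ominus> x) \<oplus> a" if a: "a \<in> carrier A" for a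
  proof -
    have "a = x \<otimes> ((\<ominus> x) \<otimes> a)"
      using a xc by (simp add: inv[symmetric] circ.m_assoc[symmetric])
    also have "\<dots> = x \<oplus> ((\<ominus> x) \<otimes> a)" using a xc by (intro socleD(2)[OF x]) simp
    finally have "(\<ominus> x) \<oplus> a = (\<ominus> x) \<oplus> (x \<oplus> ((\<ominus> x) \<otimes> a))" by simp
    then show ?thesis using a xc by (simp add: add.m_assoc[symmetric])
  qed
  moreover have "(\<ominus> x) \<oplus> a = a \<oplus> (\<ominus> x)" if a: "a \<in> carrier A" for a
    using socleD(3)[OF x, of "\<ominus> a"] a xc
    by (metis add.inv_closed add.inv_inv add.inv_mult_group)
  ultimately show "\<ominus> x \<in> socle A" using xc by (simp add: socle_def)
qed

lemma brace_ideal_socle: "brace_ideal (socle A) A"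
proof -
  have zero: "\<zero> \<in> socle A"
    unfolding socle_def using circ.l_one by (auto simp: one_eq_zero)
  have sub: "socle A \<subseteq> carrier A" by (auto simp: socle_def)
  have "subgroup (socle A) (add_monoid A)"
    by (rule subgroup.intro) (use zero sub socle_add socle_minus in \<open>auto simp: a_inv_def\<close>)
  moreover have "x \<oplus> h \<oplus> (\<ominus> x) \<in> socle A" if "x \<in> carrier A" "h \<in> socle A" for x h
  proof -
    have "x \<oplus> h = h \<oplus> x" using socleD(3)[OF that(2,1)] by simp
    then show ?thesis using that socleD(1)[of h] by (simp add: add.m_assoc)
  qed
  ultimately have 1: "socle A \<lhd> add_monoid A"
    unfolding add.normal_inv_iff by blast
  have "subgroup (socle A) A"
    by (rule subgroup.intro)
      (use zero sub socle_add socleD socle_minus in \<open>auto simp: one_eq_zero\<close>)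
  then have 2: "socle A \<lhd> A"
    unfolding circ.normal_inv_iff using socle_lambda by simp
  show ?thesis
    unfolding brace_ideal_def using 1 2 socle_lambda(1) by blast
qed

lemma brace_ideal_cosets:
  assumes I: "brace_ideal I A" and x: "x \<in> carrier A"
  shows "I #> x = I +> x"
proof -
  interpret N: normal I A using I by (simp add: brace_ideal_def)
  have ip: "I \<lhd> add_monoid A" using I by (simp add: brace_ideal_def)
  have IA: "i \<in> carrier A" if "i \<in> I" for i using that N.subset by blast
  have st: "(\<ominus> a) \<oplus> (a \<otimes> b) \<in> I" if "a \<in> carrier A" "b \<in> I" for a b
    using I that by (simp add: brace_ideal_def)
  have "I +> x = x <+ I"
    using normal.coset_eq[OF ip] x by (simp add: a_r_coset_def a_l_coset_def)
  also have "\<dots> = x <# I"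
  proof (intro equalityI subsetI)
    fix y assume "y \<in> x <+ I"
    then obtain i where i: "i \<in> I" "y = x \<oplus> i" by (auto simp: a_l_coset_def l_coset_def)
    have "x \<otimes> ((\<ominus> (inv x)) \<oplus> (inv x \<otimes> i)) = x \<oplus> i"
    proof -
      have "x \<otimes> ((\<ominus> (inv x)) \<oplus> (inv x \<otimes> i)) = ((x \<otimes> (\<ominus> (inv x))) \<ominus> x) \<oplus> i"
        using x IA[OF i(1)] by (simp add: brace_eq circ.m_assoc[symmetric])
      moreover have "\<zero> \<ominus> x \<oplus> (x \<otimes> (\<ominus> (inv x))) = x \<otimes> (inv x \<oplus> (\<ominus> (inv x))) "
        using x brace_eq[of x "inv x" "\<ominus> (inv x)"] by (simp add: one_eq_zero)
      moreover have "x \<otimes> (inv x \<oplus> (\<ominus> (inv x))) = x"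
        using x circ.r_one[of x] by (simp add: one_eq_zero)
      ultimately have "x \<otimes> (\<ominus> (inv x)) = x \<oplus> x"
        using x by (metis a_minus_def add.inv_closed add.inv_inv add.inv_solve_left add.l_one
            circ.inv_closed circ.m_closed)
      then have "(x \<otimes> (\<ominus> (inv x))) \<ominus> x = x" using x by (simp add: a_minus_def add.m_assoc)
      then show ?thesis
        using \<open>x \<otimes> ((\<ominus> (inv x)) \<oplus> (inv x \<otimes> i)) = ((x \<otimes> (\<ominus> (inv x))) \<ominus> x) \<oplus> i\<close> by simp
    qed
    moreover have "(\<ominus> (inv x)) \<oplus> (inv x \<otimes> i) \<in> I" using st x i by simp
    ultimately show "y \<in> x <# I" using i by (force simp: l_coset_def)
  next
    fix y assume "y \<in> x <# I"
    then obtain i where i: "i \<in> I" "y = x \<otimes> i" by (auto simp: l_coset_def)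
    have "y = x \<oplus> ((\<ominus> x) \<oplus> (x \<otimes> i))"
      using x i IA by (simp add: add.m_assoc[symmetric])
    then show "y \<in> x <+ I" using st[OF x i(1)] by (auto simp: a_l_coset_def l_coset_def)
  qed
  also have "\<dots> = I #> x" using N.coset_eq x by simp
  finally show ?thesis by simp
qed

lemma brace_quotient_add:
  assumes I: "brace_ideal I A" and "x \<in> carrier A" "y \<in> carrier A"
  shows "(I +> x) \<oplus>\<^bsub>A Quot I\<^esub> (I +> y) = I +> (x \<oplus> y)"
  using normal.rcos_sum[of I "add_monoid A" x y] assms
  by (simp add: brace_ideal_def FactRing_def set_add_def a_r_coset_def)

lemma brace_quotient_circ:
  assumes I: "brace_ideal I A" and x: "x \<in> carrier A" and y: "y \<in> carrier A"
  shows "(I +> x) \<otimes>\<^bsub>A Quot I\<^esub> (I +> y) = I +> (x \<otimes> y)"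
proof -
  interpret N: normal I A using I by (simp add: brace_ideal_def)
  have eq: "I +> (a \<otimes> b) = I +> (x \<otimes> y)" if a: "a \<in> I +> x" and b: "b \<in> I +> y" for a b
  proof -
    have a': "a \<in> I #> x" and b': "b \<in> I #> y"
      using a b brace_ideal_cosets[OF I] x y by simp_all
    then have c: "a \<in> carrier A" "b \<in> carrier A"
      using x y N.subset circ.r_coset_subset_G by blast+
    have "I #> a = I #> x" "I #> b = I #> y"
      using a' b' x y circ.repr_independence N.subgroup_axioms by metis+
    then have "I #> (a \<otimes> b) = I #> (x \<otimes> y)"
      using N.rcos_sum c x y by metis
    then show ?thesis using brace_ideal_cosets[OF I] c x y by simp
  qed
  have "x \<in> I +> x" "y \<in> I +> y"
    using brace_ideal_cosets[OF I] x y circ.rcos_self N.subgroup_axioms by metis+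
  then have "(\<Union>a\<in>I +> x. \<Union>b\<in>I +> y. I +> (a \<otimes> b)) = I +> (x \<otimes> y)"
    using eq by blast
  then show ?thesis by (simp add: FactRing_def rcoset_mult_def)
qed

lemma skew_left_brace_quotient:
  assumes I: "brace_ideal I A"
  shows "skew_left_brace (A Quot I)"
proof -
  interpret P: normal I "add_monoid A" using I by (simp add: brace_ideal_def)
  interpret N: normal I A using I by (simp add: brace_ideal_def)
  let ?Q = "A Quot I"
  have car: "carrier ?Q = (\<lambda>x. I +> x) ` carrier A"
    by (auto simp: FactRing_def A_RCOSETS_def RCOSETS_def a_r_coset_def)
  note addQ = brace_quotient_add[OF I] and circQ = brace_quotient_circ[OF I]
  have zeroQ: "\<zero>\<^bsub>?Q\<^esub> = I +> \<zero>"
    using add.coset_mult_one P.subset by (simp add: FactRing_def)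
  have oneQ: "\<one>\<^bsub>?Q\<^esub> = I +> \<one>" by (simp add: FactRing_def)
  have g: "group (add_monoid ?Q)"
    using P.factorgroup_is_group
    by (simp add: FactRing_def FactGroup_def A_RCOSETS_def set_add_def)
  have h: "group ?Q"
  proof (rule groupI)
    fix x assume "x \<in> carrier ?Q"
    then obtain a where a: "a \<in> carrier A" "x = I +> a" by (auto simp: car)
    then show "\<exists>y\<in>carrier ?Q. y \<otimes>\<^bsub>?Q\<^esub> x = \<one>\<^bsub>?Q\<^esub>"
      by (intro bexI[of _ "I +> inv a"]) (auto simp: circQ oneQ car)
  qed (auto simp: car circQ oneQ circ.m_assoc)
  interpret Q: group "add_monoid ?Q" by (rule g)
  have minusQ: "\<ominus>\<^bsub>?Q\<^esub> (I +> a) = I +> (\<ominus> a)" if "a \<in> carrier A" for a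
    using Q.inv_equality[of "I +> (\<ominus> a)" "I +> a"] that
    by (simp add: a_inv_def[of ?Q] addQ zeroQ car)
  have "a \<otimes>\<^bsub>?Q\<^esub> (b \<oplus>\<^bsub>?Q\<^esub> c) = ((a \<otimes>\<^bsub>?Q\<^esub> b) \<ominus>\<^bsub>?Q\<^esub> a) \<oplus>\<^bsub>?Q\<^esub> (a \<otimes>\<^bsub>?Q\<^esub> c)"
    if "a \<in> carrier ?Q" "b \<in> carrier ?Q" "c \<in> carrier ?Q" for a b c
    using that by (auto simp: car addQ circQ minusQ a_minus_def brace_eq)
  with g h show ?thesis by (rule skew_left_brace.intro)
qed

lemma inj_on_coset_rep:
  assumes "brace_ideal I A"
  shows "inj_on coset_rep (carrier (A Quot I))"
proof -
  interpret P: normal I "add_monoid A" using assms by (simp add: brace_ideal_def)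
  have "(coset_rep :: 'a set \<Rightarrow> 'a) = (\<lambda>U. SOME g. g \<in> U)"
    by (simp add: fun_eq_iff coset_rep_def)
  then show ?thesis
    using P.flatten_set_group_mod_inj by (simp add: FactRing_def FactGroup_def A_RCOSETS_def)
qed

lemma skew_left_brace_image:
  assumes "inj_on f (carrier A)"
  shows "skew_left_brace (image_ring f A)"
proof -
  let ?B = "image_ring f A"
  note [simp] = image_ring_def image_group_def monoid.defs assms
  have g: "group (add_monoid ?B)"
    using group.inj_imp_image_group_is_group[OF add_group, of f] by simp
  interpret G: group "image_group f A"
    using assms by (rule circ.inj_imp_image_group_is_group)
  have eqs: "carrier ?B = carrier (image_group f A)" "mult ?B = mult (image_group f A)"
    "one ?B = one (image_group f A)"
    by simp_all
  have h: "group ?B"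
    by (rule groupI) (auto simp del: image_ring_def image_group_def
        simp: eqs G.m_assoc intro: G.l_inv_ex)
  interpret B: group "add_monoid ?B" by (rule g)
  have car: "carrier ?B = f ` carrier A" by simp
  have addB: "f u \<oplus>\<^bsub>?B\<^esub> f v = f (u \<oplus> v)" if "u \<in> carrier A" "v \<in> carrier A" for u v
    using that by simp
  have circB: "f u \<otimes>\<^bsub>?B\<^esub> f v = f (u \<otimes> v)" if "u \<in> carrier A" "v \<in> carrier A" for u v
    using that by simp
  have zeroB: "\<zero>\<^bsub>?B\<^esub> = f \<zero>" by simp
  note [simp del] = image_ring_def image_group_def monoid.defs
  have minusB: "\<ominus>\<^bsub>?B\<^esub> (f a) = f (\<ominus> a)" if "a \<in> carrier A" for a
    using B.inv_equality[of "f (\<ominus> a)" "f a"] that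
    by (simp add: a_inv_def[of ?B] car addB zeroB)
  have "a \<otimes>\<^bsub>?B\<^esub> (b \<oplus>\<^bsub>?B\<^esub> c) = ((a \<otimes>\<^bsub>?B\<^esub> b) \<ominus>\<^bsub>?B\<^esub> a) \<oplus>\<^bsub>?B\<^esub> (a \<otimes>\<^bsub>?B\<^esub> c)"
    if "a \<in> carrier ?B" "b \<in> carrier ?B" "c \<in> carrier ?B" for a b c
    using that by (auto simp: car addB circB minusB a_minus_def brace_eq)
  with g h show ?thesis by (rule skew_left_brace.intro)
qed

end

lemma skew_left_brace_mp_series:
  assumes "skew_left_brace A"
  shows "skew_left_brace (mp_series A n)"
proof (induction n)
  case (Suc n)
  interpret skew_left_brace "mp_series A n" by (rule Suc)
  show ?case
    using skew_left_brace.skew_left_brace_image[OF skew_left_brace_quotient inj_on_coset_rep]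
      brace_ideal_socle by simp
qed (simp add: assms)

text \<open>For rings-as-records, \<^const>\<open>is_ring_iso\<close> is exactly isomorphism of skew left braces.\<close>

theorem mp_series_Suc_iso:
  assumes "skew_left_brace A"
  shows "mp_series A n Quot socle (mp_series A n) \<simeq> mp_series A (Suc n)"
proof -
  interpret skew_left_brace "mp_series A n"
    using assms by (rule skew_left_brace_mp_series)
  show ?thesis
    using inj_imp_image_ring_iso[OF inj_on_coset_rep[OF brace_ideal_socle]]
    by (auto simp: is_ring_iso_def)
qed

end

theory Submission
  imports Defs
begin

text \<open>
  Let \<open>Z_n\<close> be the preimage in \<open>A\<close> of the zero of \<open>mp_series A n\<close>; then \<open>x \<in> Z_(n+1)\<close> iff
  \<open>x * a\<close> and the additive commutator \<open>[x, a]\<close> lie in \<open>Z_n\<close> for all \<open>a\<close>. If \<open>Z_N = A\<close>, then both the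
  right series and the additive lower central series descend at least as fast as the \<open>Z_n\<close>.
  Conversely, if \<open>A^(i+1) \<subseteq> Z_N\<close> and \<open>\<gamma>_(c+1) = 0\<close>, then every \<open>x * a\<close> with \<open>x \<in> A^(i)\<close> already
  lies in \<open>Z_N\<close>, and the commutators \<open>[x, a]\<close> stay in \<open>A^(i)\<close>, which is normal in \<open>(A, +)\<close>, while
  descending the lower central series. So \<open>A^(i) \<inter> \<gamma>_(c+1-j) \<subseteq> Z_(N+j)\<close> by induction on \<open>j\<close>, and
  \<open>j = c\<close> gives \<open>A^(i) \<subseteq> Z_(N+c)\<close>.
\<close>

section \<open>Projections onto the iterated socle quotients and the resulting socle series\<close>

primrec mp_proj :: "'a ring \<Rightarrow> nat \<Rightarrow> 'a \<Rightarrow> 'a" where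
  "mp_proj A 0 x = x"
| "mp_proj A (Suc n) x = coset_rep (socle (mp_series A n) +>\<^bsub>mp_series A n\<^esub> mp_proj A n x)"

text \<open>The brace analogue of the upper central series. All its terms are subsets of
  \<open>A\<close> itself, so they can be compared with the right series and the lower central
  series, which the quotients do not allow directly.\<close>

definition upper_socle :: "'a ring \<Rightarrow> nat \<Rightarrow> 'a set" where
  "upper_socle A n = {x \<in> carrier A. mp_proj A n x = \<zero>\<^bsub>mp_series A n\<^esub>}"

text \<open>One quotient step, for an arbitrary brace so that it applies at every stage of
  \<open>mp_series\<close>: the canonical map onto the socle quotient, followed by
  \<open>coset_rep\<close>, which is injective on cosets and hence an isomorphism onto its
  image.\<close>

lemma skew_left_brace_socle_proj:
  fixes S :: "'a ring"
  assumes "skew_left_brace S"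
  defines "T \<equiv> image_ring coset_rep (S Quot socle S)"
    and "q \<equiv> \<lambda>x. coset_rep (socle S +>\<^bsub>S\<^esub> x)"
  shows "q ` carrier S = carrier T"
    and "\<And>x y. \<lbrakk>x \<in> carrier S; y \<in> carrier S\<rbrakk> \<Longrightarrow> q (x \<oplus>\<^bsub>S\<^esub> y) = q x \<oplus>\<^bsub>T\<^esub> q y"
    and "\<And>x y. \<lbrakk>x \<in> carrier S; y \<in> carrier S\<rbrakk> \<Longrightarrow> q (x \<otimes>\<^bsub>S\<^esub> y) = q x \<otimes>\<^bsub>T\<^esub> q y"
    and "\<And>x. x \<in> carrier S \<Longrightarrow> q x = \<zero>\<^bsub>T\<^esub> \<longleftrightarrow> x \<in> socle S"
proof -
  interpret skew_left_brace S by fact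
  let ?I = "socle S"
  have I: "brace_ideal ?I S" by (rule brace_ideal_socle)
  interpret P: normal ?I "add_monoid S" using I by (simp add: brace_ideal_def)
  have car: "carrier (S Quot ?I) = (\<lambda>x. ?I +>\<^bsub>S\<^esub> x) ` carrier S"
    by (auto simp: FactRing_def A_RCOSETS_def RCOSETS_def a_r_coset_def)
  have "coset_rep \<in> ring_iso (S Quot ?I) T"
    unfolding T_def by (rule inj_imp_image_ring_iso[OF inj_on_coset_rep[OF I]])
  then have hom: "coset_rep \<in> ring_hom (S Quot ?I) T"
    and bij: "bij_betw coset_rep (carrier (S Quot ?I)) (carrier T)"
    by (auto simp: ring_iso_def)
  show "q ` carrier S = carrier T"
    using bij_betw_imp_surj_on[OF bij] by (simp add: car q_def image_image)
  fix x assume x: "x \<in> carrier S"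
  show "q (x \<oplus>\<^bsub>S\<^esub> y) = q x \<oplus>\<^bsub>T\<^esub> q y" if "y \<in> carrier S" for y
    using ring_hom_add[OF hom, of "?I +>\<^bsub>S\<^esub> x" "?I +>\<^bsub>S\<^esub> y"] x that brace_quotient_add[OF I x that]
    by (simp add: car q_def)
  show "q (x \<otimes>\<^bsub>S\<^esub> y) = q x \<otimes>\<^bsub>T\<^esub> q y" if "y \<in> carrier S" for y
    using ring_hom_mult[OF hom, of "?I +>\<^bsub>S\<^esub> x" "?I +>\<^bsub>S\<^esub> y"] x that brace_quotient_circ[OF I x that]
    by (simp add: car q_def)
  have zero: "\<zero>\<^bsub>S Quot ?I\<^esub> = ?I"
    by (simp add: FactRing_def)
  have zT: "\<zero>\<^bsub>T\<^esub> = coset_rep ?I"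
    by (simp add: T_def image_ring_def zero monoid.defs)
  \<comment> \<open>The socle is the coset of zero; injectivity of \<open>coset_rep\<close> can only
    be applied between members of the quotient.\<close>
  have z: "?I \<in> carrier (S Quot ?I)"
    using add.coset_mult_one[OF P.subset[simplified]] add.one_closed unfolding car by force
  have "q x = \<zero>\<^bsub>T\<^esub> \<longleftrightarrow> ?I +>\<^bsub>S\<^esub> x = ?I"
    using inj_on_eq_iff[OF inj_on_coset_rep[OF I], of "?I +>\<^bsub>S\<^esub> x" ?I] x z by (simp add: q_def zT car)
  also have "\<dots> \<longleftrightarrow> x \<in> ?I"
    using add.coset_join1[OF _ x P.subgroup_axioms] add.coset_join2[OF x P.subgroup_axioms]
    by blast
  finally show "q x = \<zero>\<^bsub>T\<^esub> \<longleftrightarrow> x \<in> socle S" .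
qed

context
  fixes A :: "'a ring" (structure)
  assumes A: "skew_left_brace A"
begin

interpretation skew_left_brace A by (rule A)

text \<open>Surjectivity lets conditions quantified over a quotient be tested on images of elements
  of \<open>A\<close>.\<close>

lemma mp_proj_image: "mp_proj A n ` carrier A = carrier (mp_series A n)"
proof (induction n)
  case (Suc n)
  show ?case
    using skew_left_brace_socle_proj(1)[OF skew_left_brace_mp_series[OF A, of n]]
    by (simp add: Suc[symmetric] image_image)
qed simp

lemma mp_proj_closed: "x \<in> carrier A \<Longrightarrow> mp_proj A n x \<in> carrier (mp_series A n)"
  using mp_proj_image by blast

lemma mp_proj_hom:
  assumes "x \<in> carrier A" "y \<in> carrier A"
  shows "mp_proj A n (x \<oplus> y) = mp_proj A n x \<oplus>\<^bsub>mp_series A n\<^esub> mp_proj A n y"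
    and "mp_proj A n (x \<otimes> y) = mp_proj A n x \<otimes>\<^bsub>mp_series A n\<^esub> mp_proj A n y"
  by (induction n)
    (use assms in \<open>simp_all add: mp_proj_closed
      skew_left_brace_socle_proj(2,3)[OF skew_left_brace_mp_series[OF A]]\<close>)

lemma mp_proj_group_hom:
  "group_hom (add_monoid A) (add_monoid (mp_series A n)) (mp_proj A n)"
  using add_group skew_left_brace.add_group[OF skew_left_brace_mp_series[OF A]]
  by (simp add: group_hom_def group_hom_axioms_def hom_def mp_proj_closed mp_proj_hom(1))

lemma subgroup_upper_socle: "subgroup (upper_socle A n) (add_monoid A)"
  using group_hom.subgroup_kernel[OF mp_proj_group_hom, of n]
  by (simp add: upper_socle_def kernel_def)

lemma upper_socle_0: "upper_socle A 0 = {\<zero>}"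
  by (auto simp: upper_socle_def)

lemma mp_proj_minus:
  "x \<in> carrier A \<Longrightarrow> mp_proj A n (\<ominus> x) = \<ominus>\<^bsub>mp_series A n\<^esub> mp_proj A n x"
  using group_hom.hom_inv[OF mp_proj_group_hom, of x n] by (simp add: a_inv_def)

lemma upper_socle_Suc_iff_socle:
  assumes "x \<in> carrier A"
  shows "x \<in> upper_socle A (Suc n) \<longleftrightarrow> mp_proj A n x \<in> socle (mp_series A n)"
  using skew_left_brace_socle_proj(4)[OF skew_left_brace_mp_series[OF A] mp_proj_closed] assms
  by (simp add: upper_socle_def)

lemma brace_star_closed [simp]:
  "\<lbrakk>x \<in> carrier A; a \<in> carrier A\<rbrakk> \<Longrightarrow> brace_star A x a \<in> carrier A"
  by (simp add: brace_star_def a_minus_def)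

text \<open>The two defining equations of the socle, pulled back along the surjective homomorphism
  \<open>mp_proj A n\<close>: each holds for the images of \<open>x\<close> and \<open>a\<close>
  exactly when the projection kills the star product or the commutator, respectively.\<close>

lemma upper_socle_Suc_iff:
  assumes x: "x \<in> carrier A"
  shows "x \<in> upper_socle A (Suc n) \<longleftrightarrow> (\<forall>a \<in> carrier A.
    brace_star A x a \<in> upper_socle A n \<and> x \<oplus> a \<oplus> \<ominus> x \<oplus> \<ominus> a \<in> upper_socle A n)"
proof -
  let ?S = "mp_series A n" and ?p = "mp_proj A n"
  interpret S: skew_left_brace ?S by (rule skew_left_brace_mp_series[OF A])
  have 1: "brace_star A x a \<in> upper_socle A n \<longleftrightarrow> ?p x \<otimes>\<^bsub>?S\<^esub> ?p a = ?p x \<oplus>\<^bsub>?S\<^esub> ?p a"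
    if "a \<in> carrier A" for a
  proof -
    let ?x = "?p x" and ?a = "?p a"
    have c: "?x \<in> carrier ?S" "?a \<in> carrier ?S" using x that by (auto intro: mp_proj_closed)
    have "brace_star A x a \<in> upper_socle A n \<longleftrightarrow>
        \<ominus>\<^bsub>?S\<^esub> ?x \<oplus>\<^bsub>?S\<^esub> ?x \<otimes>\<^bsub>?S\<^esub> ?a \<oplus>\<^bsub>?S\<^esub> \<ominus>\<^bsub>?S\<^esub> ?a = \<zero>\<^bsub>?S\<^esub>"
      using x that by (simp add: upper_socle_def brace_star_def a_minus_def mp_proj_hom mp_proj_minus)
    \<comment> \<open>The last summand is moved to the right-hand side first, then the first
      one.\<close>
    also have "\<dots> \<longleftrightarrow> ?x \<otimes>\<^bsub>?S\<^esub> ?a = ?x \<oplus>\<^bsub>?S\<^esub> ?a"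
      using c S.add.inv_solve_right'[of "\<zero>\<^bsub>?S\<^esub>" "\<ominus>\<^bsub>?S\<^esub> ?x \<oplus>\<^bsub>?S\<^esub> ?x \<otimes>\<^bsub>?S\<^esub> ?a" ?a]
        S.add.inv_solve_left'[of ?a ?x "?x \<otimes>\<^bsub>?S\<^esub> ?a"] by auto
    finally show ?thesis .
  qed
  have 2: "x \<oplus> a \<oplus> \<ominus> x \<oplus> \<ominus> a \<in> upper_socle A n \<longleftrightarrow> ?p x \<oplus>\<^bsub>?S\<^esub> ?p a = ?p a \<oplus>\<^bsub>?S\<^esub> ?p x"
    if "a \<in> carrier A" for a
  proof -
    let ?x = "?p x" and ?a = "?p a"
    have c: "?x \<in> carrier ?S" "?a \<in> carrier ?S" using x that by (auto intro: mp_proj_closed)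
    have "x \<oplus> a \<oplus> \<ominus> x \<oplus> \<ominus> a \<in> upper_socle A n \<longleftrightarrow>
        ?x \<oplus>\<^bsub>?S\<^esub> ?a \<oplus>\<^bsub>?S\<^esub> \<ominus>\<^bsub>?S\<^esub> ?x \<oplus>\<^bsub>?S\<^esub> \<ominus>\<^bsub>?S\<^esub> ?a = \<zero>\<^bsub>?S\<^esub>"
      using x that by (simp add: upper_socle_def mp_proj_hom mp_proj_minus)
    also have "\<dots> \<longleftrightarrow> ?x \<oplus>\<^bsub>?S\<^esub> ?a = ?a \<oplus>\<^bsub>?S\<^esub> ?x"
      using c S.add.inv_solve_right'[of "\<zero>\<^bsub>?S\<^esub>" "?x \<oplus>\<^bsub>?S\<^esub> ?a \<oplus>\<^bsub>?S\<^esub> \<ominus>\<^bsub>?S\<^esub> ?x" ?a]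
        S.add.inv_solve_right'[of ?a "?x \<oplus>\<^bsub>?S\<^esub> ?a" ?x] by auto
    finally show ?thesis .
  qed
  have "?p x \<in> socle ?S \<longleftrightarrow> (\<forall>a \<in> carrier A.
      ?p x \<otimes>\<^bsub>?S\<^esub> ?p a = ?p x \<oplus>\<^bsub>?S\<^esub> ?p a \<and> ?p x \<oplus>\<^bsub>?S\<^esub> ?p a = ?p a \<oplus>\<^bsub>?S\<^esub> ?p x)"
    using mp_proj_closed[OF x] by (auto simp: socle_def mp_proj_image[symmetric])
  then show ?thesis
    using upper_socle_Suc_iff_socle[OF x] 1 2 by simp
qed

text \<open>Zero lies in every socle, so an element killed at one stage is also killed at the
  next.\<close>

lemma upper_socle_mono: "m \<le> n \<Longrightarrow> upper_socle A m \<subseteq> upper_socle A n"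
proof (rule lift_Suc_mono_le[of "upper_socle A"])
  fix n
  interpret S: skew_left_brace "mp_series A n" by (rule skew_left_brace_mp_series[OF A])
  have "\<zero>\<^bsub>mp_series A n\<^esub> \<in> socle (mp_series A n)"
    using S.brace_ideal_socle subgroup.one_closed
    by (fastforce simp: brace_ideal_def normal_def)
  then show "upper_socle A n \<subseteq> upper_socle A (Suc n)"
    using upper_socle_Suc_iff_socle[of _ n] unfolding upper_socle_def[of A n] by auto
qed

lemma finite_multipermutation_level_iff:
  "finite_multipermutation_level A \<longleftrightarrow> (\<exists>n. upper_socle A n = carrier A)"
proof -
  have "zero_brace (mp_series A n) \<longleftrightarrow> upper_socle A n = carrier A" for n
  proof -
    have "mp_proj A n \<zero> = \<zero>\<^bsub>mp_series A n\<^esub>"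
      using group_hom.hom_one[OF mp_proj_group_hom, of n] by simp
    then show ?thesis
      unfolding zero_brace_def mp_proj_image[symmetric] upper_socle_def
      using add.one_closed by force
  qed
  then show ?thesis
    by (simp add: finite_multipermutation_level_def)
qed

section \<open>Closure properties of the right series and the lower central series\<close>

lemma right_series_subset: "right_series A n \<subseteq> carrier A"
proof (induction n)
  case (Suc n)
  then have "{brace_star A x y | x y. x \<in> right_series A n \<and> y \<in> carrier A} \<subseteq> carrier A"
    by auto
  from add.generate_incl[OF this] show ?case by (simp add: brace_star_set_def)
qed simp

lemma lower_central_subset: "lower_central (add_monoid A) n \<subseteq> carrier A"
proof (induction n)
  case (Suc n)
  have "generate (add_monoid A) {x \<oplus> y \<oplus> \<ominus> x \<oplus> \<ominus> y | x y.
      x \<in> lower_central (add_monoid A) n \<and> y \<in> carrier A} \<subseteq> carrier A"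
    by (rule add.generate_incl) (use Suc in \<open>auto\<close>)
  then show ?case by (simp add: a_inv_def)
qed simp

lemma zero_in_right_series: "\<zero> \<in> right_series A n"
  using generate.one[of "add_monoid A"] by (cases n) (auto simp: brace_star_set_def)

lemma zero_in_lower_central: "\<zero> \<in> lower_central (add_monoid A) n"
  using generate.one[of "add_monoid A"] by (cases n) auto

lemma add_minus_cancel [simp]:
  assumes "a \<in> carrier A" "b \<in> carrier A"
  shows "\<ominus> a \<oplus> (a \<oplus> b) = b" and "a \<oplus> (\<ominus> a \<oplus> b) = b"
  using assms by (simp_all flip: add.m_assoc)

text \<open>The brace equation gives \<open>x * (a + b) = x * a + (a + x * b - a)\<close>. So the
  conjugate of a generator \<open>x * b\<close> by \<open>a\<close> is
  \<open>-(x * a) + x * (a + b)\<close>, a combination of generators with the same \<open>x\<close>.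
  Conjugation then extends to the generated subgroup.\<close>

lemma right_series_normal: "right_series A n \<lhd> add_monoid A"
proof (cases n)
  case 0
  then show ?thesis
    using add.subgroup_self unfolding add.normal_inv_iff by simp
next
  case (Suc m)
  let ?S = "{brace_star A x y | x y. x \<in> right_series A m \<and> y \<in> carrier A}"
  have S: "?S \<subseteq> carrier A" using right_series_subset[of m] by auto
  have sub: "subgroup (generate (add_monoid A) ?S) (add_monoid A)"
    by (rule add.generate_is_subgroup[OF S])
  have gen: "a \<oplus> s \<oplus> \<ominus> a \<in> generate (add_monoid A) ?S"
    if s: "s \<in> ?S" and a: "a \<in> carrier A" for s a
  proof -
    obtain x b where x: "x \<in> right_series A m" and b: "b \<in> carrier A" and s: "s = brace_star A x b"
      using s by blast
    have xc: "x \<in> carrier A" using x right_series_subset by blast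
    have "brace_star A x a \<oplus> (a \<oplus> s \<oplus> \<ominus> a) = brace_star A x (a \<oplus> b)"
      using xc b a
      by (simp add: s brace_star_def a_minus_def brace_eq add.m_assoc add.inv_mult_group)
    then have "a \<oplus> s \<oplus> \<ominus> a = \<ominus> (brace_star A x a) \<oplus> brace_star A x (a \<oplus> b)"
      using xc b a by (metis s add.inv_closed add.m_closed add_minus_cancel(1) brace_star_closed)
    moreover have "brace_star A x a \<in> generate (add_monoid A) ?S"
      "brace_star A x (a \<oplus> b) \<in> generate (add_monoid A) ?S"
      using x b a by (blast intro: generate.incl add.m_closed)+
    ultimately show ?thesis
      using subgroup.m_closed[OF sub] subgroup.m_inv_closed[OF sub] by (simp add: a_inv_def)
  qed
  have "generate (add_monoid A) ?S \<lhd> add_monoid A"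
    unfolding add.normal_inv_iff
  proof (intro conjI ballI sub)
    fix a x assume a: "a \<in> carrier A" and "x \<in> generate (add_monoid A) ?S"
    from this(2) show "a \<oplus> x \<oplus> \<ominus> a \<in> generate (add_monoid A) ?S"
    proof (induction rule: generate.induct)
      case one
      then show ?case using a generate.one[of "add_monoid A"] by simp
    next
      case (incl h)
      then show ?case using a by (rule gen)
    next
      case (inv h)
      then have h: "h \<in> carrier A" using S by blast
      \<comment> \<open>The conjugate of \<open>-h\<close> is the negative of the conjugate of
        \<open>h\<close>.\<close>
      have "\<ominus> (a \<oplus> h \<oplus> \<ominus> a) \<in> generate (add_monoid A) ?S"
        using subgroup.m_inv_closed[OF sub gen[OF inv a]] by (simp add: a_inv_def)
      moreover have "inv\<^bsub>add_monoid A\<^esub> h = \<ominus> h" by (simp add: a_inv_def)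
      ultimately show ?case using h a by (simp add: add.inv_mult_group add.m_assoc)
    next
      case (eng g h)
      have gh: "g \<in> carrier A" "h \<in> carrier A"
        using eng(1,2) add.generate_incl[OF S] by blast+
      have "(a \<oplus> g \<oplus> \<ominus> a) \<oplus> (a \<oplus> h \<oplus> \<ominus> a) = a \<oplus> (g \<oplus> h) \<oplus> \<ominus> a"
        using gh a by (simp add: add.m_assoc)
      then show ?case using subgroup.m_closed[OF sub eng(3,4)] by simp
    qed
  qed
  then show ?thesis by (simp add: Suc brace_star_set_def)
qed

text \<open>The commutator is \<open>x\<close> plus a conjugate of \<open>-x\<close>, and both lie
  in the normal subgroup.\<close>

lemma right_series_commutator:
  assumes x: "x \<in> right_series A n" and a: "a \<in> carrier A"
  shows "x \<oplus> a \<oplus> \<ominus> x \<oplus> \<ominus> a \<in> right_series A n"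
proof -
  interpret N: normal "right_series A n" "add_monoid A" by (rule right_series_normal)
  have "\<ominus> x \<in> right_series A n"
    using N.m_inv_closed[OF x] by (simp add: a_inv_def)
  then have "x \<oplus> (a \<oplus> \<ominus> x \<oplus> \<ominus> a) \<in> right_series A n"
    using N.inv_op_closed2[of a "\<ominus> x"] N.m_closed[OF x] a by (simp add: a_inv_def)
  then show ?thesis
    using x a right_series_subset by (auto simp: add.m_assoc subset_iff)
qed

section \<open>Comparison of the socle series with the other two series, in both directions\<close>

lemma right_series_subset_upper_socle:
  assumes "upper_socle A N = carrier A" "k \<le> N"
  shows "right_series A k \<subseteq> upper_socle A (N - k)"
  using assms(2)
proof (induction k)
  case 0
  then show ?case using assms(1) by simp
next
  case (Suc k)
  \<comment> \<open>\<open>Suc k \<le> N\<close> rules out truncated subtraction, so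
    \<open>upper_socle_Suc_iff\<close> applies and moves each generator down one level. The target
    is a subgroup, so it contains everything they generate.\<close>
  then have "N - k = Suc (N - Suc k)" by simp
  then have IH: "x \<in> upper_socle A (Suc (N - Suc k))" if "x \<in> right_series A k" for x
    using Suc that by auto
  then have "{brace_star A x y | x y. x \<in> right_series A k \<and> y \<in> carrier A}
      \<subseteq> upper_socle A (N - Suc k)"
    using upper_socle_Suc_iff right_series_subset by blast
  then show ?case
    using add.generate_subgroup_incl[OF _ subgroup_upper_socle] by (simp add: brace_star_set_def)
qed

lemma lower_central_subset_upper_socle:
  assumes "upper_socle A N = carrier A" "k \<le> N"
  shows "lower_central (add_monoid A) k \<subseteq> upper_socle A (N - k)"
  using assms(2)
proof (induction k)
  case 0
  then show ?case using assms(1) by simp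
next
  case (Suc k)
  then have "N - k = Suc (N - Suc k)" by simp
  then have IH: "x \<in> upper_socle A (Suc (N - Suc k))" if "x \<in> lower_central (add_monoid A) k" for x
    using Suc that by auto
  then have "{x \<oplus> y \<oplus> \<ominus> x \<oplus> \<ominus> y | x y. x \<in> lower_central (add_monoid A) k \<and> y \<in> carrier A}
      \<subseteq> upper_socle A (N - Suc k)"
    using upper_socle_Suc_iff lower_central_subset by blast
  then show ?case
    using add.generate_subgroup_incl[OF _ subgroup_upper_socle] by (simp add: a_inv_def)
qed

text \<open>Star products enter \<open>upper_socle A N\<close> by the first assumption and stay in
  the later terms by monotonicity; only the commutators use the induction hypothesis, as they stay
  in \<open>right_series A i\<close> and go one step down the lower central series.\<close>

lemma right_series_inter_lower_central_subset:
  assumes "right_series A (Suc i) \<subseteq> upper_socle A N"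
    and "lower_central (add_monoid A) c = {\<zero>}"
    and "j \<le> c"
  shows "right_series A i \<inter> lower_central (add_monoid A) (c - j) \<subseteq> upper_socle A (N + j)"
  using assms(3)
proof (induction j)
  case 0
  then show ?case
    using assms(2) subgroup.one_closed[OF subgroup_upper_socle] by auto
next
  case (Suc j)
  show ?case
  proof
    fix x assume "x \<in> right_series A i \<inter> lower_central (add_monoid A) (c - Suc j)"
    then have x: "x \<in> right_series A i" "x \<in> lower_central (add_monoid A) (c - Suc j)" by auto
    have xc: "x \<in> carrier A" using x right_series_subset by blast
    have "brace_star A x a \<in> upper_socle A (N + j) \<and>
        x \<oplus> a \<oplus> \<ominus> x \<oplus> \<ominus> a \<in> upper_socle A (N + j)" if a: "a \<in> carrier A" for a
    proof
      have "brace_star A x a \<in> right_series A (Suc i)"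
        using x a by (auto simp: brace_star_set_def intro: generate.incl)
      then show "brace_star A x a \<in> upper_socle A (N + j)"
        using assms(1) upper_socle_mono[of N "N + j"] by auto
      have "x \<oplus> a \<oplus> \<ominus> x \<oplus> \<ominus> a \<in> lower_central (add_monoid A) (Suc (c - Suc j))"
        using x a by (auto simp: a_inv_def intro!: generate.incl)
      moreover have "Suc (c - Suc j) = c - j" using Suc.prems by simp
      ultimately show "x \<oplus> a \<oplus> \<ominus> x \<oplus> \<ominus> a \<in> upper_socle A (N + j)"
        using right_series_commutator[OF x(1) a] Suc by auto
    qed
    then show "x \<in> upper_socle A (N + Suc j)"
      using upper_socle_Suc_iff[OF xc] by simp
  qed
qed

text \<open>Climbs the right series from its zero term up to \<open>A\<close>; every step up costs
  \<open>c\<close> further levels of the socle series.\<close>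

lemma right_series_subset_upper_socle_of_nilpotent:
  assumes "right_series A m = {\<zero>}" "lower_central (add_monoid A) c = {\<zero>}" "i \<le> m"
  shows "right_series A (m - i) \<subseteq> upper_socle A (i * c)"
  using assms(3)
proof (induction i)
  case 0
  then show ?case using assms(1) upper_socle_0 by simp
next
  case (Suc i)
  then have "Suc (m - Suc i) = m - i" by simp
  then have "right_series A (Suc (m - Suc i)) \<subseteq> upper_socle A (i * c)"
    using Suc by simp
  \<comment> \<open>With \<open>j = c\<close> the lower central term has index 0 and is the whole
    carrier, so the intersection is the right series term itself.\<close>
  from right_series_inter_lower_central_subset[OF this assms(2) order.refl]
  show ?case using right_series_subset[of "m - Suc i"] by (auto simp: add.commute)
qed

lemma finite_multipermutation_level_iff_nilpotent:
  "finite_multipermutation_level A \<longleftrightarrow> right_nilpotent A \<and> nilpotent_group (add_monoid A)"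
proof
  assume "finite_multipermutation_level A"
  then obtain N where N: "upper_socle A N = carrier A"
    using finite_multipermutation_level_iff by blast
  \<comment> \<open>At \<open>k = N\<close> both series lie in \<open>upper_socle A 0\<close>, which
    is zero.\<close>
  have "right_series A N = {\<zero>}" "lower_central (add_monoid A) N = {\<zero>}"
    using right_series_subset_upper_socle[OF N, of N] lower_central_subset_upper_socle[OF N, of N]
      zero_in_right_series[of N] zero_in_lower_central[of N] upper_socle_0 by auto
  then show "right_nilpotent A \<and> nilpotent_group (add_monoid A)"
    using add_group by (auto simp: right_nilpotent_def nilpotent_group_def)
next
  assume "right_nilpotent A \<and> nilpotent_group (add_monoid A)"
  then obtain m c where "right_series A m = {\<zero>}" "lower_central (add_monoid A) c = {\<zero>}"
    by (auto simp: right_nilpotent_def nilpotent_group_def)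
  \<comment> \<open>Here \<open>i = m\<close>, so the right series term has index 0 and is all of
    \<open>A\<close>.\<close>
  from right_series_subset_upper_socle_of_nilpotent[OF this order.refl]
  have "upper_socle A (m * c) = carrier A"
    by (auto simp: upper_socle_def)
  then show "finite_multipermutation_level A"
    using finite_multipermutation_level_iff by blast
qed

end

theorem theorem2p20:
  fixes A :: "'a ring"
  assumes "skew_left_brace A"
  shows "finite_multipermutation_level A \<longleftrightarrow>
    right_nilpotent A \<and> nilpotent_group (add_monoid A)"
  using assms by (rule finite_multipermutation_level_iff_nilpotent)

end
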